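(* Let $m\geq 2$ and $k\geq 1$ be integers, let $P(x,y)=\mathrm{Re}\,(x+iy)^m$ (a homogeneous real polynomial of degree $m$) and $Q(x,y)=(x^2+y^2)^k$ (a homogeneous real polynomial of degree $2k$), and let $n=m+2k$ be the degree of the product $f=QP$. Suppose that $m\leq n<m^2$. Then the quadratic differential form $II_f$ is hyperbolic isotopic to the quadratic differential form $II_P$.
   Context: Write $\mathbb{R}^{2^*}=\mathbb{R}^2\setminus\{(0,0)\}$. For a polynomial $g\in\mathbb{R}[x,y]$, its second fundamental form is the quadratic differential form $II_g=g_{xx}\,dx^2+2g_{xy}\,dx\,dy+g_{yy}\,dy^2$ on the plane. Let $\mathcal{Q}$ be the space of real quadratic forms on the plane. A quadratic differential form $a\,dx^2+2b\,dx\,dy+c\,dy^2$ has discriminant $b^2-ac$; it is called hyperbolic on $\mathbb{R}^{2^*}$ if its discriminant is positive at every point of $\mathbb{R}^{2^*}$. A quadratic differential form on $\mathbb{R}^{2^*}$ extends to the origin with a singularity if it extends to the origin and the extended form has a singularity there, i.e. its coefficients all vanish at the origin. A hyperbolic isotopy between two smooth hyperbolic quadratic differential forms $\omega$ and $\delta$ on $\mathbb{R}^{2^*}$ that extend to the origin with a singularity is a smooth map $$\Psi:\mathbb{R}^{2^*}\times[0,1]\to\mathcal{Q},\qquad (x,y,t)\mapsto\Psi_t(x,y),$$ such that $\Psi_0(x,y)=\omega(x,y)$, $\Psi_1(x,y)=\delta(x,y)$, and for each $t\in[0,1]$ the form $\Psi_t$ is a smooth hyperbolic quadratic differential form on $\mathbb{R}^{2^*}$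 which extends to the origin with a singularity. In this case $\omega$ and $\delta$ are said to be hyperbolic isotopic. *)

theory Defs
  imports "HOL-Analysis.Analysis"
begin

section \<open>Smooth maps\<close>

text \<open>
  Class \<open>C\<^sup>k\<close>, meant for open \<open>U\<close>: the derivatives are taken along every fixed direction
  \<open>v\<close>, so that all iterated derivatives keep the type of \<open>f\<close>. In finite dimension this is
  the usual notion.
\<close>

fun Ck_on_open :: "nat \<Rightarrow> 'a::euclidean_space set \<Rightarrow> ('a \<Rightarrow> 'b::real_normed_vector) \<Rightarrow> bool" where
  "Ck_on_open 0 U f \<longleftrightarrow> continuous_on U f"
| "Ck_on_open (Suc k) U f \<longleftrightarrow>
     (\<forall>x\<in>U. f differentiable (at x)) \<and>
     (\<forall>v. Ck_on_open k U (\<lambda>x. frechet_derivative f (at x) v))"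

text \<open>
  Smoothness on an arbitrary set: locally the restriction of a \<open>C\<^sup>\<infinity>\<close> map defined on an
  open set. For open \<open>S\<close> this is ordinary smoothness; the general case is needed for the
  cylinder over \<open>[0,1]\<close>, which has a boundary.
\<close>

definition smooth_on :: "'a::euclidean_space set \<Rightarrow> ('a \<Rightarrow> 'b::real_normed_vector) \<Rightarrow> bool" where
  "smooth_on S f \<longleftrightarrow>
     (\<forall>x\<in>S. \<exists>U F. open U \<and> x \<in> U \<and> (\<forall>k. Ck_on_open k U F) \<and> (\<forall>y\<in>S \<inter> U. F y = f y))"


section \<open>Quadratic differential forms on the plane\<close>

text \<open>
  The three-dimensional space of real quadratic forms on the plane: the triple \<open>(a, b, c)\<close>
  stands for \<open>a dx\<^sup>2 + 2 b dx dy + c dy\<^sup>2\<close>. Note the factor 2 in the middle term.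
\<close>

type_synonym qform = "real \<times> real \<times> real"

text \<open>
  A quadratic differential form assigns a quadratic form to each point. Those that live only
  on the punctured plane are total functions whose value at the origin is ignored.
\<close>

type_synonym qdform = "real \<times> real \<Rightarrow> qform"

definition punctured_plane :: "(real \<times> real) set" where
  "punctured_plane = UNIV - {(0, 0)}"

fun discriminant :: "qform \<Rightarrow> real" where
  "discriminant (a, b, c) = b\<^sup>2 - a * c"

definition hyperbolic :: "qdform \<Rightarrow> bool" where
  "hyperbolic \<omega> \<longleftrightarrow> (\<forall>p\<in>punctured_plane. discriminant (\<omega> p) > 0)"

text \<open>The extension to the origin is required to be a smooth quadratic differential form.\<close>

definition extends_with_singularity :: "qdform \<Rightarrow> bool" where
  "extends_with_singularity \<omega> \<longleftrightarrow>
     (\<exists>\<omega>'. smooth_on UNIV \<omega>' \<and> (\<forall>p\<in>punctured_plane. \<omega>' p = \<omega> p) \<and> \<omega>' (0, 0) = (0, 0, 0))"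

definition admissible :: "qdform \<Rightarrow> bool" where
  "admissible \<omega> \<longleftrightarrow>
     smooth_on punctured_plane \<omega> \<and> hyperbolic \<omega> \<and> extends_with_singularity \<omega>"

definition hyperbolic_isotopy :: "qdform \<Rightarrow> qdform \<Rightarrow> (real \<times> real \<Rightarrow> real \<Rightarrow> qform) \<Rightarrow> bool" where
  "hyperbolic_isotopy \<omega> \<delta> \<Psi> \<longleftrightarrow>
     admissible \<omega> \<and> admissible \<delta> \<and>
     smooth_on (punctured_plane \<times> {0..1}) (\<lambda>(p, t). \<Psi> p t) \<and>
     (\<forall>p\<in>punctured_plane. \<Psi> p 0 = \<omega> p \<and> \<Psi> p 1 = \<delta> p) \<and>
     (\<forall>t\<in>{0..1}. admissible (\<lambda>p. \<Psi> p t))"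

definition hyperbolic_isotopic :: "qdform \<Rightarrow> qdform \<Rightarrow> bool" where
  "hyperbolic_isotopic \<omega> \<delta> \<longleftrightarrow> (\<exists>\<Psi>. hyperbolic_isotopy \<omega> \<delta> \<Psi>)"


section \<open>The second fundamental form\<close>

text \<open>
  Real polynomials in two variables are identified with the functions they induce, so their
  partial derivatives are the analytic ones.
\<close>

definition partial_x :: "(real \<times> real \<Rightarrow> real) \<Rightarrow> real \<times> real \<Rightarrow> real" where
  "partial_x g = (\<lambda>(x, y). deriv (\<lambda>s. g (s, y)) x)"

definition partial_y :: "(real \<times> real \<Rightarrow> real) \<Rightarrow> real \<times> real \<Rightarrow> real" where
  "partial_y g = (\<lambda>(x, y). deriv (\<lambda>s. g (x, s)) y)"

definition second_fundamental_form :: "(real \<times> real \<Rightarrow> real) \<Rightarrow> qdform" where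
  "second_fundamental_form g =
     (\<lambda>p. (partial_x (partial_x g) p, partial_y (partial_x g) p, partial_y (partial_y g) p))"

end

theory Submission
  imports Defs
begin

text \<open>
  In the complex coordinate \<open>z = x + i y\<close> a real quadratic form is
  \<open>Re (\<alpha> dz\<^sup>2) + \<beta> |dz|\<^sup>2\<close>, with discriminant \<open>|\<alpha>|\<^sup>2 - \<beta>\<^sup>2\<close>. Since
  \<open>f = Re (z\<^bsup>m+k\<^esup> w\<^bsup>k\<^esup>)\<close>, where \<open>w\<close> is the conjugate of \<open>z\<close>, the straight segment
  \<open>(1 - t) II\<^sub>f + t II\<^sub>P\<close> satisfies, with \<open>z\<^bsup>m\<^esup> = u + i v\<close>, \<open>R = |z|\<^bsup>2k\<^esup>\<close>,
  \<open>A = (m+k)(m+k-1)\<close>, \<open>B = k(k-1)\<close> and \<open>C = m(m-1)\<close>,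
  \<open>|z\<^sup>2 \<alpha>|\<^sup>2 = ((1-t)R(A+B) + tC)\<^sup>2 u\<^sup>2 + ((1-t)R(A-B) + tC)\<^sup>2 v\<^sup>2\<close> and
  \<open>|z|\<^sup>2 \<beta> = (1-t)R 2(m+k)k u\<close>. As \<open>A + B - 2(m+k)k = m\<^sup>2 - n > 0\<close> and
  \<open>A > B\<close>, the whole segment is hyperbolic.
\<close>

section \<open>Smoothness of polynomial maps\<close>

text \<open>Induction over the four ways of building a polynomial produces some derivative
  \<open>f'\<close> whose value in each fixed direction is polynomial in the base point. Uniqueness
  of the Frechet derivative transfers this to \<open>frechet_derivative\<close>.\<close>

lemma real_polynomial_function_frechet_derivative:
  fixes f :: "'a::euclidean_space \<Rightarrow> real"
  assumes "real_polynomial_function f"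
  shows "f differentiable (at x)"
    and "real_polynomial_function (\<lambda>x. frechet_derivative f (at x) v)"
proof -
  have "\<exists>f'. (\<forall>x. (f has_derivative f' x) (at x)) \<and> (\<forall>v. real_polynomial_function (\<lambda>x. f' x v))"
    using assms
  proof induction
    case (linear f)
    show ?case
    proof (intro exI[of _ "\<lambda>x. f"] conjI allI)
      show "(f has_derivative f) (at x)" for x
        using linear by (rule bounded_linear_imp_has_derivative)
      show "real_polynomial_function (\<lambda>x. f v)" for v
        by (rule real_polynomial_function.intros)
    qed
  next
    case (const c)
    show ?case
    proof (intro exI[of _ "\<lambda>x v. 0"] conjI allI)
      show "((\<lambda>x. c) has_derivative (\<lambda>v. 0)) (at x)" for x :: 'a
        by (rule has_derivative_const)
      show "real_polynomial_function (\<lambda>x::'a. 0)"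
        by (rule real_polynomial_function.intros)
    qed
  next
    case (add f g)
    from add.IH(1) obtain f' where f': "\<And>x. (f has_derivative f' x) (at x)"
        "\<And>v. real_polynomial_function (\<lambda>x. f' x v)"
      by metis
    from add.IH(2) obtain g' where g': "\<And>x. (g has_derivative g' x) (at x)"
        "\<And>v. real_polynomial_function (\<lambda>x. g' x v)"
      by metis
    show ?case
    proof (intro exI[of _ "\<lambda>x v. f' x v + g' x v"] conjI allI)
      show "((\<lambda>x. f x + g x) has_derivative (\<lambda>v. f' x v + g' x v)) (at x)" for x
        by (rule has_derivative_add[OF f'(1) g'(1)])
      show "real_polynomial_function (\<lambda>x. f' x v + g' x v)" for v
        by (rule real_polynomial_function.intros(3)[OF f'(2) g'(2)])
    qed
  next
    case (mult f g)
    from mult.IH(1) obtain f' where f': "\<And>x. (f has_derivative f' x) (at x)"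
        "\<And>v. real_polynomial_function (\<lambda>x. f' x v)"
      by metis
    from mult.IH(2) obtain g' where g': "\<And>x. (g has_derivative g' x) (at x)"
        "\<And>v. real_polynomial_function (\<lambda>x. g' x v)"
      by metis
    show ?case
    proof (intro exI[of _ "\<lambda>x v. f x * g' x v + f' x v * g x"] conjI allI)
      show "((\<lambda>x. f x * g x) has_derivative (\<lambda>v. f x * g' x v + f' x v * g x)) (at x)" for x
        by (rule has_derivative_mult[OF f'(1) g'(1)])
      show "real_polynomial_function (\<lambda>x. f x * g' x v + f' x v * g x)" for v
        by (rule real_polynomial_function.intros(3)[OF real_polynomial_function.intros(4)[OF mult.hyps(1) g'(2)]
              real_polynomial_function.intros(4)[OF f'(2) mult.hyps(2)]])
    qed
  qed
  then obtain f' where f': "\<And>x. (f has_derivative f' x) (at x)"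
    "\<And>v. real_polynomial_function (\<lambda>x. f' x v)" by blast
  from f'(1) show "f differentiable (at x)" by (auto simp: differentiable_def)
  from f' show "real_polynomial_function (\<lambda>x. frechet_derivative f (at x) v)"
    by (simp add: frechet_derivative_at[OF f'(1), symmetric])
qed

text \<open>A vector-valued map is polynomial when its composition with every bounded linear
  functional is, and such functionals commute with differentiation; this reduces to the scalar
  case.\<close>

lemma polynomial_function_frechet_derivative:
  fixes f :: "'a::euclidean_space \<Rightarrow> 'b::euclidean_space"
  assumes "polynomial_function f"
  shows "polynomial_function (\<lambda>x. frechet_derivative f (at x) v)"
  unfolding polynomial_function_def
proof (intro allI impI)
  fix h :: "'b \<Rightarrow> real"
  assume h: "bounded_linear h"
  have "frechet_derivative (h \<circ> f) (at x) v = h (frechet_derivative f (at x) v)" for x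
  proof -
    have "(f has_derivative frechet_derivative f (at x)) (at x)"
      using differentiable_at_polynomial_function[OF assms] by (simp add: frechet_derivative_works)
    from bounded_linear.has_derivative[OF h this] show ?thesis
      by (simp add: frechet_derivative_at[symmetric] o_def)
  qed
  moreover have "real_polynomial_function (h \<circ> f)"
    using assms h by (simp add: polynomial_function_def)
  ultimately show "real_polynomial_function (h \<circ> (\<lambda>x. frechet_derivative f (at x) v))"
    using real_polynomial_function_frechet_derivative(2)[of "h \<circ> f" v] by (simp add: o_def)
qed

text \<open>Directional derivatives of a polynomial map are again polynomial, so the induction on
  \<open>k\<close> runs with \<open>f\<close> arbitrary.\<close>

lemma Ck_on_open_polynomial_function:
  fixes f :: "'a::euclidean_space \<Rightarrow> 'b::euclidean_space"
  assumes "polynomial_function f"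
  shows "Ck_on_open k U f"
  using assms
proof (induction k arbitrary: f)
  case 0
  then show ?case by (simp add: continuous_on_polymonial_function)
next
  case (Suc k)
  then show ?case
    by (simp add: differentiable_at_polynomial_function polynomial_function_frechet_derivative)
qed

lemma smooth_on_polynomial_function:
  fixes f :: "'a::euclidean_space \<Rightarrow> 'b::euclidean_space"
  assumes "polynomial_function f"
  shows "smooth_on S f"
  unfolding smooth_on_def
  using Ck_on_open_polynomial_function[OF assms] by (intro ballI exI[of _ UNIV] exI[of _ f]) auto

lemma polynomial_function_Pair:
  fixes f :: "'a::euclidean_space \<Rightarrow> 'b::euclidean_space" and g :: "'a \<Rightarrow> 'c::euclidean_space"
  assumes "polynomial_function f" "polynomial_function g"
  shows "polynomial_function (\<lambda>x. (f x, g x))"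
  using assms by (auto simp: polynomial_function_iff_Basis_inner Basis_prod_def)

lemma polynomial_function_complex_iff:
  fixes f :: "'a::euclidean_space \<Rightarrow> complex"
  shows "polynomial_function f \<longleftrightarrow>
    real_polynomial_function (\<lambda>x. Re (f x)) \<and> real_polynomial_function (\<lambda>x. Im (f x))"
  by (auto simp: polynomial_function_iff_Basis_inner Basis_complex_def)

lemma polynomial_function_Complex:
  fixes g h :: "'a::euclidean_space \<Rightarrow> real"
  assumes "real_polynomial_function g" "real_polynomial_function h"
  shows "polynomial_function (\<lambda>x. Complex (g x) (h x))"
  using assms by (simp add: polynomial_function_complex_iff)

lemma polynomial_function_cnj:
  fixes f :: "'a::euclidean_space \<Rightarrow> complex"
  assumes "polynomial_function f"
  shows "polynomial_function (\<lambda>x. cnj (f x))"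
  using assms by (simp add: polynomial_function_complex_iff real_polynomial_function_minus)

lemma polynomial_function_times_complex:
  fixes f g :: "'a::euclidean_space \<Rightarrow> complex"
  assumes "polynomial_function f" "polynomial_function g"
  shows "polynomial_function (\<lambda>x. f x * g x)"
  using assms unfolding polynomial_function_complex_iff
  by (simp add: real_polynomial_function.intros(3,4) real_polynomial_function_diff)

lemma polynomial_function_power_complex:
  fixes f :: "'a::euclidean_space \<Rightarrow> complex"
  assumes "polynomial_function f"
  shows "polynomial_function (\<lambda>x. f x ^ n)"
  by (induction n) (simp_all add: polynomial_function_times_complex assms)


section \<open>Quadratic forms in the complex coordinate\<close>

text \<open>The triple of Re(\<alpha> dz^2) + \<beta> |dz|^2. The middle entry is half the dx dy
  coefficient -2 Im \<alpha>, by the convention for \<open>qform\<close>.\<close>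

definition complex_qform :: "complex \<Rightarrow> real \<Rightarrow> qform" where
  "complex_qform \<alpha> \<beta> = (Re \<alpha> + \<beta>, - Im \<alpha>, \<beta> - Re \<alpha>)"

lemma discriminant_complex_qform: "discriminant (complex_qform \<alpha> \<beta>) = (cmod \<alpha>)\<^sup>2 - \<beta>\<^sup>2"
  by (simp add: complex_qform_def cmod_power2) (simp add: power2_eq_square algebra_simps)

lemma complex_qform_linear:
  "c *\<^sub>R complex_qform \<alpha> \<beta> + d *\<^sub>R complex_qform \<alpha>' \<beta>' =
    complex_qform (of_real c * \<alpha> + of_real d * \<alpha>') (c * \<beta> + d * \<beta>')"
  by (simp add: complex_qform_def algebra_simps)

lemma polynomial_function_complex_qform:
  fixes \<alpha> :: "'a::euclidean_space \<Rightarrow> complex"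
  assumes "polynomial_function \<alpha>" "real_polynomial_function \<beta>"
  shows "polynomial_function (\<lambda>x. complex_qform (\<alpha> x) (\<beta> x))"
proof -
  have "real_polynomial_function (\<lambda>x. Re (\<alpha> x))" "real_polynomial_function (\<lambda>x. Im (\<alpha> x))"
    using assms(1) by (simp_all add: polynomial_function_complex_iff)
  with assms(2) show ?thesis
    unfolding complex_qform_def real_polynomial_function_eq
    by (intro polynomial_function_Pair polynomial_function_add polynomial_function_minus
        polynomial_function_diff)
qed

section \<open>Second derivatives of monomials in z and its conjugate\<close>

text \<open>The coefficient is complex because differentiating in y brings out factors i and -i;
  with it, each partial derivative is a sum of two functions of the same kind.\<close>

definition zmonomial :: "complex \<Rightarrow> nat \<Rightarrow> nat \<Rightarrow> real \<times> real \<Rightarrow> real" where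
  "zmonomial c a b = (\<lambda>(x, y). Re (c * Complex x y ^ a * cnj (Complex x y) ^ b))"

text \<open>Lets a real partial derivative be read off from the complex derivative of a holomorphic
  extension in the moving variable.\<close>

lemma has_real_derivative_Re_of_real:
  assumes "(h has_field_derivative h') (at (complex_of_real x))"
  shows "((\<lambda>s. Re (h (of_real s))) has_field_derivative Re h') (at x)"
  using bounded_linear.has_vector_derivative[OF bounded_linear_Re has_vector_derivative_real_field[OF assms]]
  by (simp add: has_real_derivative_iff_has_vector_derivative)

lemma zmonomial_eq:
  "zmonomial c a b (x, y) =
    Re (c * (of_real x + \<i> * of_real y) ^ a * (of_real x - \<i> * of_real y) ^ b)"
  by (simp add: zmonomial_def Complex_eq)

lemma zmonomial_derivative_x:
  "((\<lambda>s. zmonomial c a b (s, y)) has_field_derivative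
    (zmonomial (of_nat a * c) (a - 1) b (x, y) + zmonomial (of_nat b * c) a (b - 1) (x, y))) (at x)"
proof -
  \<comment> \<open>With y fixed, writing the conjugate as \<open>w - \<i> * of_real y\<close> makes
    the expression a polynomial in a complex \<open>w\<close>, although conjugation itself is not
    holomorphic.\<close>
  let ?h = "\<lambda>w. c * (w + \<i> * of_real y) ^ a * (w - \<i> * of_real y) ^ b"
  let ?z = "of_real x + \<i> * of_real y" and ?w = "of_real x - \<i> * of_real y"
  have "(?h has_field_derivative of_nat a * c * ?z ^ (a - 1) * ?w ^ b + of_nat b * c * ?z ^ a * ?w ^ (b - 1))
    (at (of_real x))"
    by (auto intro!: derivative_eq_intros)
  from has_real_derivative_Re_of_real[OF this] show ?thesis
    unfolding zmonomial_eq plus_complex.sel .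
qed

lemma zmonomial_derivative_y:
  "((\<lambda>s. zmonomial c a b (x, s)) has_field_derivative
    (zmonomial (\<i> * of_nat a * c) (a - 1) b (x, y) + zmonomial (- \<i> * of_nat b * c) a (b - 1) (x, y))) (at y)"
proof -
  let ?h = "\<lambda>w. c * (of_real x + \<i> * w) ^ a * (of_real x - \<i> * w) ^ b"
  let ?z = "of_real x + \<i> * of_real y" and ?w = "of_real x - \<i> * of_real y"
  have "(?h has_field_derivative
      \<i> * of_nat a * c * ?z ^ (a - 1) * ?w ^ b + - \<i> * of_nat b * c * ?z ^ a * ?w ^ (b - 1))
    (at (of_real y))"
    by (auto intro!: derivative_eq_intros)
  from has_real_derivative_Re_of_real[OF this] show ?thesis
    unfolding zmonomial_eq plus_complex.sel .
qed

lemma partial_x_zmonomial: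
  "partial_x (zmonomial c a b) =
    (\<lambda>p. zmonomial (of_nat a * c) (a - 1) b p + zmonomial (of_nat b * c) a (b - 1) p)"
  by (auto simp only: partial_x_def fun_eq_iff split: prod.split intro!: DERIV_imp_deriv zmonomial_derivative_x)

lemma partial_y_zmonomial:
  "partial_y (zmonomial c a b) =
    (\<lambda>p. zmonomial (\<i> * of_nat a * c) (a - 1) b p + zmonomial (- \<i> * of_nat b * c) a (b - 1) p)"
  by (auto simp only: partial_y_def fun_eq_iff split: prod.split intro!: DERIV_imp_deriv zmonomial_derivative_y)

text \<open>Additivity of \<open>deriv\<close> rests on differentiability, which the explicit
  derivatives of the monomials supply.\<close>

lemma partial_x_zmonomial_add:
  "partial_x (\<lambda>p. zmonomial c a b p + zmonomial c' a' b' p) =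
    (\<lambda>p. partial_x (zmonomial c a b) p + partial_x (zmonomial c' a' b') p)"
  unfolding partial_x_zmonomial
  by (auto simp only: partial_x_def fun_eq_iff split: prod.split
      intro!: DERIV_imp_deriv DERIV_add zmonomial_derivative_x)

lemma partial_y_zmonomial_add:
  "partial_y (\<lambda>p. zmonomial c a b p + zmonomial c' a' b' p) =
    (\<lambda>p. partial_y (zmonomial c a b) p + partial_y (zmonomial c' a' b') p)"
  unfolding partial_y_zmonomial
  by (auto simp only: partial_y_def fun_eq_iff split: prod.split
      intro!: DERIV_imp_deriv DERIV_add zmonomial_derivative_y)

text \<open>
  Truncated subtraction in the exponents is harmless here: wherever it truncates, the
  coefficient vanishes.
\<close>

definition hess_holo :: "nat \<Rightarrow> nat \<Rightarrow> complex \<Rightarrow> complex" where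
  "hess_holo a b z = of_nat (a * (a - 1)) * z ^ (a - 2) * cnj z ^ b
    + of_nat (b * (b - 1)) * z ^ (b - 2) * cnj z ^ a"

definition hess_mixed :: "nat \<Rightarrow> nat \<Rightarrow> complex \<Rightarrow> real" where
  "hess_mixed a b z = 2 * real (a * b) * Re (z ^ (a - 1) * cnj z ^ (b - 1))"

text \<open>For g = \<open>z^a * cnj z^b\<close>, the numbers \<open>X\<close>, \<open>Y\<close>,
  \<open>Z\<close> are its second derivatives in (z,z), (z,\<open>cnj z\<close>) and
  (\<open>cnj z\<close>,\<open>cnj z\<close>). The form of Re g is Re(X dz^2 + 2 Y |dz|^2 + Z
  conj(dz)^2), and conjugating the last term inside Re gives \<alpha> = X + \<open>cnj Z\<close> and
  \<beta> = 2 Re Y.\<close>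

lemma second_fundamental_form_zmonomial:
  "second_fundamental_form (zmonomial 1 a b) (x, y) =
    complex_qform (hess_holo a b (Complex x y)) (hess_mixed a b (Complex x y))"
proof -
  define X where "X = of_nat (a * (a - 1)) * Complex x y ^ (a - 2) * cnj (Complex x y) ^ b"
  define Y where "Y = of_nat (a * b) * Complex x y ^ (a - 1) * cnj (Complex x y) ^ (b - 1)"
  define Z where "Z = of_nat (b * (b - 1)) * Complex x y ^ a * cnj (Complex x y) ^ (b - 2)"
  have conv: "a - 1 - 1 = a - 2" "b - 1 - 1 = b - 2" by auto
  have hol: "hess_holo a b (Complex x y) = X + cnj Z"
    by (simp add: hess_holo_def X_def Z_def mult.assoc mult.left_commute mult.commute)
  have mix: "hess_mixed a b (Complex x y) = 2 * Re Y"
  proof -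
    have "Y = of_real (real (a * b)) * (Complex x y ^ (a - 1) * cnj (Complex x y) ^ (b - 1))"
      by (simp add: Y_def)
    then show ?thesis by (simp only: hess_mixed_def Re_complex_of_real Im_complex_of_real times_complex.simps) simp
  qed
  have m: "zmonomial c a' b' (x, y) = Re (c * (Complex x y ^ a' * cnj (Complex x y) ^ b'))" for c a' b'
    by (simp add: zmonomial_def mult.assoc)
  \<comment> \<open>Collecting the summands under one \<open>Re\<close> reduces each entry to an
    identity between complex numbers.\<close>
  note Re_add = plus_complex.sel(1)[symmetric]
  have xx: "partial_x (partial_x (zmonomial 1 a b)) (x, y) = Re (X + 2 * Y + Z)"
    unfolding partial_x_zmonomial partial_x_zmonomial_add conv m X_def Y_def Z_def Re_add
    by (rule arg_cong[where f = Re]) (simp add: mult_ac)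
  have xy: "partial_y (partial_x (zmonomial 1 a b)) (x, y) = Re (\<i> * X - \<i> * Z)"
    unfolding partial_x_zmonomial partial_y_zmonomial_add partial_y_zmonomial conv m X_def Y_def Z_def Re_add
    by (rule arg_cong[where f = Re]) (simp add: mult_ac)
  have yy: "partial_y (partial_y (zmonomial 1 a b)) (x, y) = Re (2 * Y - X - Z)"
    unfolding partial_y_zmonomial_add partial_y_zmonomial conv m X_def Y_def Z_def Re_add
    by (rule arg_cong[where f = Re]) (simp add: mult_ac)
  show ?thesis
    unfolding second_fundamental_form_def xx xy yy hol mix complex_qform_def by simp
qed

section \<open>Positivity of the discriminant along the segment\<close>

text \<open>The factor \<open>z\<^sup>2\<close> restores the lowered exponents, leaving only the
  original monomial and its conjugate.\<close>

lemma square_times_hess_holo: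
  "z\<^sup>2 * hess_holo a b z =
    of_nat (a * (a - 1)) * (z ^ a * cnj z ^ b) + of_nat (b * (b - 1)) * cnj (z ^ a * cnj z ^ b)"
proof -
  have *: "z\<^sup>2 * (of_nat (d * (d - 1)) * z ^ (d - 2)) = of_nat (d * (d - 1)) * z ^ d" for d
  proof (cases "d \<ge> 2")
    case True
    then have "z ^ d = z\<^sup>2 * z ^ (d - 2)" by (metis le_add_diff_inverse power_add)
    then show ?thesis by (simp add: mult.left_commute)
  next
    case False
    then have "d * (d - 1) = 0" by auto
    then show ?thesis by (simp only: of_nat_0 mult_zero_left mult_zero_right)
  qed
  have "z\<^sup>2 * hess_holo a b z = z\<^sup>2 * (of_nat (a * (a - 1)) * z ^ (a - 2)) * cnj z ^ b
      + z\<^sup>2 * (of_nat (b * (b - 1)) * z ^ (b - 2)) * cnj z ^ a"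
    by (simp add: hess_holo_def distrib_left mult.assoc del: of_nat_mult)
  then show ?thesis unfolding * by (simp add: mult.assoc mult.commute mult.left_commute)
qed

text \<open>Here |z|^2 = z \<open>cnj z\<close> restores one factor of each kind.\<close>

lemma square_times_hess_mixed:
  "(cmod z)\<^sup>2 * hess_mixed a b z = 2 * real (a * b) * Re (z ^ a * cnj z ^ b)"
proof (cases "a * b = 0")
  case False
  then obtain a' b' where ab: "a = Suc a'" "b = Suc b'" by (metis mult_is_0 not0_implies_Suc)
  have "z ^ a * cnj z ^ b = of_real ((cmod z)\<^sup>2) * (z ^ a' * cnj z ^ b')"
    unfolding ab by (simp add: complex_norm_square mult_ac del: of_real_power)
  then have "Re (z ^ a * cnj z ^ b) = (cmod z)\<^sup>2 * Re (z ^ a' * cnj z ^ b')"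
    by (simp only: Re_complex_of_real Im_complex_of_real times_complex.simps)
  then show ?thesis by (simp add: hess_mixed_def ab)
qed (auto simp: hess_mixed_def)

text \<open>Strictness comes from \<open>s < p\<close> if \<open>u\<close> is nonzero, and from
  \<open>0 < q\<close> otherwise.\<close>

lemma sum_squares_dominates:
  fixes p q s u v :: real
  assumes "0 \<le> s" "s < p" "0 < q" "u \<noteq> 0 \<or> v \<noteq> 0"
  shows "(s * u)\<^sup>2 < (p * u)\<^sup>2 + (q * v)\<^sup>2"
proof (cases "u = 0")
  case True
  then show ?thesis using assms by simp
next
  case False
  have "s\<^sup>2 < p\<^sup>2" using assms by (intro power_strict_mono) auto
  with False have "s\<^sup>2 * u\<^sup>2 < p\<^sup>2 * u\<^sup>2" by (intro mult_strict_right_mono) auto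
  also have "\<dots> \<le> p\<^sup>2 * u\<^sup>2 + q\<^sup>2 * v\<^sup>2" by simp
  finally show ?thesis by (simp add: power_mult_distrib)
qed

text \<open>Multiplying \<alpha> by z^2 and \<beta> by |z|^2 scales the discriminant by |z|^4 > 0,
  so its sign can be read from the real coefficients \<open>p\<close>, \<open>q\<close>,
  \<open>s\<close> of \<open>u\<close> and \<open>v\<close>.\<close>

lemma discriminant_segment_pos:
  fixes m k :: nat and t :: real
  assumes "z \<noteq> 0" "k \<ge> 1" "m + 2 * k < m\<^sup>2" "0 \<le> t" "t \<le> 1"
  defines "\<alpha> \<equiv> of_real (1 - t) * hess_holo (m + k) k z + of_real t * hess_holo m 0 z"
    and "\<beta> \<equiv> (1 - t) * hess_mixed (m + k) k z + t * hess_mixed m 0 z"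
  shows "discriminant (complex_qform \<alpha> \<beta>) > 0"
proof -
  define R where "R = (cmod z) ^ (2 * k)"
  define A B C where "A = real ((m + k) * (m + k - 1))" and "B = real (k * (k - 1))"
    and "C = real (m * (m - 1))"
  define u v where "u = Re (z ^ m)" and "v = Im (z ^ m)"
  define p q s where "p = (1 - t) * R * (A + B) + t * C" and "q = (1 - t) * R * (A - B) + t * C"
    and "s = (1 - t) * R * (2 * real ((m + k) * k))"
  have m: "m \<ge> 2"
  proof (rule ccontr)
    assume "\<not> m \<ge> 2"
    then have "m = 0 \<or> m = 1" by auto
    with assms show False by auto
  qed
  have "R > 0" using assms by (simp add: R_def)
  have A: "A = (real m + real k) * (real m + real k - 1)" and B: "B = real k * (real k - 1)"
    and C: "C = real m * (real m - 1)"
    using m \<open>k \<ge> 1\<close> by (simp_all add: A_def B_def C_def of_nat_diff)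
  have "real (m + 2 * k) < real (m\<^sup>2)" using assms(3) by (simp only: of_nat_less_iff)
  \<comment> \<open>The degree bound enters: the left side equals m^2 - (m + 2k).\<close>
  then have AB: "A + B - 2 * real ((m + k) * k) > 0"
    by (simp add: A B power2_eq_square algebra_simps)
  have "A - B = real m * (real m - 1) + 2 * real m * real k"
    using m by (simp add: A B of_nat_diff algebra_simps)
  with m \<open>k \<ge> 1\<close> have AB': "A - B > 0" by (simp add: add_nonneg_pos)
  have C: "C > 0" using m by (simp add: C)
  \<comment> \<open>Applied to \<open>A + B - 2 * real ((m + k) * k)\<close>, where it is
    \<open>p - s\<close>, and to \<open>A - B\<close>, where it is \<open>q\<close>. For
    \<open>t = 0\<close> the first summand is positive, for \<open>t > 0\<close> the second.\<close>
  have pos: "(1 - t) * R * a + t * C > 0" if "a > 0" for a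
  proof (cases "t = 0")
    case True then show ?thesis using that \<open>R > 0\<close> by simp
  next
    case False then show ?thesis using that \<open>R > 0\<close> C assms by (intro add_nonneg_pos) auto
  qed
  have "s \<ge> 0" using assms \<open>R > 0\<close> by (simp add: s_def)
  moreover have "s < p" using pos[OF AB] by (simp add: s_def p_def algebra_simps)
  moreover have "0 < q" using pos[OF AB'] by (simp add: q_def)
  moreover have "u \<noteq> 0 \<or> v \<noteq> 0"
    using \<open>z \<noteq> 0\<close> complex_eq_iff[of "z ^ m" 0] by (auto simp: u_def v_def)
  ultimately have key: "(s * u)\<^sup>2 < (p * u)\<^sup>2 + (q * v)\<^sup>2" by (rule sum_squares_dominates)

  have W: "z ^ (m + k) * cnj z ^ k = of_real R * z ^ m"
  proof -
    have "z ^ (m + k) * cnj z ^ k = z ^ m * (z * cnj z) ^ k"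
      by (simp add: power_add power_mult_distrib)
    also have "z * cnj z = of_real ((cmod z)\<^sup>2)" by (simp only: complex_norm_square)
    finally show ?thesis by (simp add: R_def mult.commute flip: power_mult)
  qed
  have "z\<^sup>2 * \<alpha> = of_real (1 - t) * (z\<^sup>2 * hess_holo (m + k) k z) + of_real t * (z\<^sup>2 * hess_holo m 0 z)"
    by (simp add: \<alpha>_def algebra_simps)
  also have "\<dots> = of_real (1 - t) * (of_real A * (of_real R * z ^ m) + of_real B * cnj (of_real R * z ^ m))
      + of_real t * (of_real C * z ^ m)"
    unfolding square_times_hess_holo W by (simp add: A_def B_def C_def)
  \<comment> \<open>Conjugation fixes \<open>u\<close> and negates \<open>v\<close>, hence
    \<open>A + B\<close> in \<open>p\<close> and \<open>A - B\<close> in \<open>q\<close>.\<close>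
  finally have za: "z\<^sup>2 * \<alpha> = Complex (p * u) (q * v)"
    by (simp add: complex_eq_iff p_def q_def u_def v_def algebra_simps flip: complex_cnj_power)
  \<comment> \<open>P is harmonic: its mixed term vanishes, having no conjugate factor.\<close>
  have "(cmod z)\<^sup>2 * \<beta> = (1 - t) * ((cmod z)\<^sup>2 * hess_mixed (m + k) k z)"
    by (simp add: \<beta>_def hess_mixed_def)
  also have "\<dots> = s * u"
    unfolding square_times_hess_mixed W by (simp add: s_def u_def)
  finally have zb: "(cmod z)\<^sup>2 * \<beta> = s * u" .
  have "((cmod z)\<^sup>2)\<^sup>2 * ((cmod \<alpha>)\<^sup>2 - \<beta>\<^sup>2) = (cmod (z\<^sup>2 * \<alpha>))\<^sup>2 - ((cmod z)\<^sup>2 * \<beta>)\<^sup>2"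
    by (simp add: norm_mult norm_power power_mult_distrib algebra_simps)
  also have "\<dots> > 0" using key unfolding za zb by (simp add: cmod_power2)
  finally show ?thesis
    by (simp add: discriminant_complex_qform zero_less_mult_iff)
qed

section \<open>Polynomial dependence and vanishing at the origin\<close>

lemma polynomial_function_hess_holo:
  fixes f :: "'a::euclidean_space \<Rightarrow> complex"
  assumes "polynomial_function f"
  shows "polynomial_function (\<lambda>x. hess_holo a b (f x))"
  unfolding hess_holo_def
  by (intro polynomial_function_add polynomial_function_times_complex polynomial_function_power_complex
      polynomial_function_cnj assms polynomial_function_const)

lemma polynomial_function_hess_mixed:
  fixes f :: "'a::euclidean_space \<Rightarrow> complex"
  assumes "polynomial_function f"
  shows "real_polynomial_function (\<lambda>x. hess_mixed a b (f x))"
proof -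
  have "polynomial_function (\<lambda>x. f x ^ (a - 1) * cnj (f x) ^ (b - 1))"
    by (intro polynomial_function_times_complex polynomial_function_power_complex polynomial_function_cnj assms)
  then have "real_polynomial_function (\<lambda>x. Re (f x ^ (a - 1) * cnj (f x) ^ (b - 1)))"
    unfolding polynomial_function_complex_iff by (rule conjunct1)
  from real_polynomial_function.intros(4)[OF real_polynomial_function.intros(2) this]
  show ?thesis
    unfolding hess_mixed_def .
qed

text \<open>Composition with \<open>g\<close> serves two cases: the identity on the plane, and the
  projection from the product with the time axis.\<close>

lemma polynomial_function_second_fundamental_form_zmonomial:
  fixes g :: "'a::euclidean_space \<Rightarrow> real \<times> real"
  assumes "polynomial_function g"
  shows "polynomial_function (\<lambda>q. second_fundamental_form (zmonomial 1 a b) (g q))"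
proof -
  have "real_polynomial_function (h \<circ> g)" if "bounded_linear h" for h
    using assms that by (simp add: polynomial_function_def)
  from this[OF bounded_linear_fst] this[OF bounded_linear_snd]
  have *: "polynomial_function (\<lambda>q. Complex (fst (g q)) (snd (g q)))"
    by (simp add: o_def polynomial_function_Complex)
  have "polynomial_function (\<lambda>q. complex_qform
      (hess_holo a b (Complex (fst (g q)) (snd (g q)))) (hess_mixed a b (Complex (fst (g q)) (snd (g q)))))"
    by (intro polynomial_function_complex_qform polynomial_function_hess_holo polynomial_function_hess_mixed *)
  then show ?thesis
    by (simp flip: second_fundamental_form_zmonomial)
qed

text \<open>In total degree at least 3, each term with nonzero coefficient keeps positive degree
  after two differentiations.\<close>

lemma second_fundamental_form_zmonomial_origin:
  assumes "a + b \<ge> 3"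
  shows "second_fundamental_form (zmonomial 1 a b) (0, 0) = (0, 0, 0)"
proof -
  have "Complex 0 0 = 0" by (simp add: complex_eq_iff)
  moreover have "hess_holo a b 0 = 0"
  proof -
    have "a = 0 \<Longrightarrow> b \<noteq> 2" "b = 0 \<Longrightarrow> a \<noteq> 2" using assms by auto
    then show ?thesis using assms by (auto simp: hess_holo_def power_0_left)
  qed
  moreover have "hess_mixed a b 0 = 0"
    using assms by (auto simp: hess_mixed_def power_0_left)
  ultimately show ?thesis
    unfolding second_fundamental_form_zmonomial by (simp add: complex_qform_def)
qed

theorem theorem3:
  fixes m k n :: nat
    and P Q f :: "real \<times> real \<Rightarrow> real"
  assumes "m \<ge> 2" and "k \<ge> 1"
    and "\<And>x y. P (x, y) = Re ((complex_of_real x + \<i> * complex_of_real y) ^ m)"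
    and "\<And>x y. Q (x, y) = (x\<^sup>2 + y\<^sup>2) ^ k"
    and "\<And>p. f p = Q p * P p"
    and "n = m + 2 * k"
    and "m \<le> n" and "n < m\<^sup>2"
  shows "hyperbolic_isotopic (second_fundamental_form f) (second_fundamental_form P)"
proof -
  have P: "P = zmonomial 1 m 0"
    by (auto simp: fun_eq_iff assms(3) zmonomial_eq)
  have "f (x, y) = zmonomial 1 (m + k) k (x, y)" for x y
  proof -
    let ?z = "complex_of_real x + \<i> * complex_of_real y"
    let ?w = "complex_of_real x - \<i> * complex_of_real y"
    have zw: "?z * ?w = of_real (x\<^sup>2 + y\<^sup>2)"
      by (simp add: complex_eq_iff power2_eq_square)
    have "1 * ?z ^ (m + k) * ?w ^ k = (?z * ?w) ^ k * ?z ^ m"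
      by (simp add: power_add power_mult_distrib)
    also have "\<dots> = of_real ((x\<^sup>2 + y\<^sup>2) ^ k) * ?z ^ m"
      by (simp only: zw of_real_power)
    finally have "1 * ?z ^ (m + k) * ?w ^ k = of_real ((x\<^sup>2 + y\<^sup>2) ^ k) * ?z ^ m" .
    then show ?thesis
      by (simp only: zmonomial_eq assms(3-5) Re_complex_of_real Im_complex_of_real times_complex.simps)
  qed
  then have f: "f = zmonomial 1 (m + k) k" by auto
  let ?F = "second_fundamental_form f" and ?P = "second_fundamental_form P"
  define \<Psi> where "\<Psi> p t = (1 - t) *\<^sub>R ?F p + t *\<^sub>R ?P p" for p :: "real \<times> real" and t :: real
  \<comment> \<open>For m = 2 the bound would read 2 + 2k < 4, against k >= 1. So m >= 3, and the
    form of P vanishes at the origin rather than being a nonzero constant.\<close>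
  have "m \<noteq> 2" using assms by auto
  then have orig: "\<Psi> (0, 0) t = (0, 0, 0)" for t
    using assms by (simp add: \<Psi>_def f P second_fundamental_form_zmonomial_origin)
  have poly: "polynomial_function (\<lambda>p. \<Psi> p t)" for t
    unfolding \<Psi>_def f P
    by (intro polynomial_function_add polynomial_function_cmul
        polynomial_function_second_fundamental_form_zmonomial polynomial_function_id)
  have "polynomial_function (\<lambda>q. \<Psi> (fst q) (snd q))"
    unfolding \<Psi>_def f P
    by (intro polynomial_function_add polynomial_function_mult polynomial_function_diff
        polynomial_function_second_fundamental_form_zmonomial polynomial_function_const
        polynomial_function_bounded_linear bounded_linear_fst bounded_linear_snd)
  \<comment> \<open>Joint polynomiality in \<open>(p, t)\<close> gives a global smooth extension, so
    the boundary of the cylinder causes no difficulty.\<close>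
  then have smooth: "smooth_on S (\<lambda>(p, t). \<Psi> p t)" for S
    by (simp add: smooth_on_polynomial_function case_prod_unfold)
  have adm: "admissible (\<lambda>p. \<Psi> p t)" if "t \<in> {0..1}" for t
    unfolding admissible_def
  proof (intro conjI)
    show "smooth_on punctured_plane (\<lambda>p. \<Psi> p t)"
      using poly by (rule smooth_on_polynomial_function)
    show "extends_with_singularity (\<lambda>p. \<Psi> p t)"
      unfolding extends_with_singularity_def
      using smooth_on_polynomial_function[OF poly, of UNIV t] orig by blast
    show "hyperbolic (\<lambda>p. \<Psi> p t)"
      unfolding hyperbolic_def
    proof
      fix p assume p: "p \<in> punctured_plane"
      obtain x y where xy: "p = (x, y)" by (cases p)
      then have "Complex x y \<noteq> 0" using p by (auto simp: punctured_plane_def complex_eq_iff)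
      from discriminant_segment_pos[OF this, of k m t] show "discriminant (\<Psi> p t) > 0"
        using assms that
        by (simp add: \<Psi>_def f P xy second_fundamental_form_zmonomial complex_qform_linear del: discriminant.simps)
    qed
  qed
  \<comment> \<open>As equalities of functions, these turn \<open>adm\<close> at times 0 and 1 into
    admissibility of the two given forms.\<close>
  have ends: "(\<lambda>p. \<Psi> p 0) = ?F" "(\<lambda>p. \<Psi> p 1) = ?P" by (auto simp: \<Psi>_def)
  have "hyperbolic_isotopy ?F ?P \<Psi>"
    unfolding hyperbolic_isotopy_def
    using adm[of 0] adm[of 1] adm smooth by (simp add: ends) (simp add: \<Psi>_def)
  then show ?thesis by (auto simp: hyperbolic_isotopic_def)
qed

end
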